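(* Let $G=(V,E)$ be a graph with $|E|\geq 1$. Then the following statements are equivalent: (a) $I_G=\langle 0\rangle$, i.e. $\mathbb{K}[G]$ is regular; (b) $G=K_2$ or $G=K_3$.
   Context: $\mathbb{K}$ is a field. All graphs are finite and simple with non-empty vertex set. $K_n$ is the complete graph on $n$ vertices. For a graph $G=(V,E)$ let $S_G=\mathbb{K}[q_{A|B}]$ be the polynomial ring with one variable for each unordered partition $A|B$ of $V$ (i.e. $A\cup B=V$, $A\cap B=\emptyset$, empty parts allowed), and $R_G=\mathbb{K}[s_{ij},t_{ij}:\{i,j\}\in E]$. Let $\mathrm{Cut}(A|B)\subseteq E$ be the set of edges with one endpoint in $A$ and the other in $B$. Let $\phi_G\colon S_G\to R_G$ be the $\mathbb{K}$-algebra homomorphism $q_{A|B}\mapsto \prod_{\{i,j\}\in \mathrm{Cut}(A|B)}s_{ij}\prod_{\{i,j\}\in E\setminus \mathrm{Cut}(A|B)}t_{ij}$. The cut ideal of $G$ is $I_G=\ker\phi_G$. The cut algebra $\mathbb{K}[G]$ of $G$ is the $\mathbb{K}$-subalgebra of $R_G$ given by the image of $\phi_G$, so $\mathbb{K}[G]\cong S_G/I_G$. *)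

theory Defs
  imports "HOL-Library.Poly_Mapping"
begin

definition simple_graph :: "'v set \<Rightarrow> 'v set set \<Rightarrow> bool" where
  "simple_graph V E \<longleftrightarrow> finite V \<and> V \<noteq> {} \<and> (\<forall>e\<in>E. e \<subseteq> V \<and> card e = 2)"

definition graph_iso :: "'v set \<Rightarrow> 'v set set \<Rightarrow> 'w set \<Rightarrow> 'w set set \<Rightarrow> bool" where
  "graph_iso V E V' E' \<longleftrightarrow>
     (\<exists>f. bij_betw f V V' \<and> (\<forall>u\<in>V. \<forall>v\<in>V. {u, v} \<in> E \<longleftrightarrow> {f u, f v} \<in> E'))"

text \<open>The vertex set of \<open>K_n\<close> is \<open>{..<n}\<close>; that a graph equals \<open>K_n\<close> is understood, as usual,
  up to isomorphism.\<close>

definition complete_edges :: "nat \<Rightarrow> nat set set" where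
  "complete_edges n = {e. e \<subseteq> {..<n} \<and> card e = 2}"

definition is_complete_graph :: "nat \<Rightarrow> 'v set \<Rightarrow> 'v set set \<Rightarrow> bool" where
  "is_complete_graph n V E \<longleftrightarrow> graph_iso V E {..<n} (complete_edges n)"

text \<open>Commutative polynomials with variables of type \<open>'x\<close>: a monomial is a finitely supported
  exponent function, a polynomial a finitely supported coefficient function on monomials. The ring
  operations are those of \<^theory>\<open>HOL-Library.Poly_Mapping\<close>.\<close>

type_synonym ('x, 'k) mpoly = "('x \<Rightarrow>\<^sub>0 nat) \<Rightarrow>\<^sub>0 'k"

definition Const :: "'k::zero \<Rightarrow> ('x, 'k) mpoly" where
  "Const c = Poly_Mapping.single 0 c"

definition Var :: "'x \<Rightarrow> ('x, 'k::zero_neq_one) mpoly" where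
  "Var x = Poly_Mapping.single (Poly_Mapping.single x 1) 1"

definition poly_ring :: "'x set \<Rightarrow> ('x, 'k::zero) mpoly set" where
  "poly_ring X = {p. \<forall>m \<in> Poly_Mapping.keys p. Poly_Mapping.keys m \<subseteq> X}"

text \<open>The \<open>'k\<close>-algebra homomorphism that sends each variable \<open>x\<close> to \<open>f x\<close>.\<close>

definition poly_subst ::
    "('x \<Rightarrow> ('y, 'k::comm_ring_1) mpoly) \<Rightarrow> ('x, 'k) mpoly \<Rightarrow> ('y, 'k) mpoly" where
  "poly_subst f p =
     (\<Sum>m \<in> Poly_Mapping.keys p. Const (Poly_Mapping.lookup p m) *
        (\<Prod>x \<in> Poly_Mapping.keys m. f x ^ Poly_Mapping.lookup m x))"

text \<open>An unordered partition \<open>A|B\<close> is the set \<open>{A, B}\<close>. As \<open>V\<close> is non-empty, \<open>A \<noteq> B\<close>.\<close>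

definition partitions :: "'v set \<Rightarrow> 'v set set set" where
  "partitions V = {{A, B} | A B. A \<union> B = V \<and> A \<inter> B = {}}"

definition Cut :: "'v set set \<Rightarrow> 'v set set \<Rightarrow> 'v set set" where
  "Cut E P = {e \<in> E. \<exists>A B i j. P = {A, B} \<and> e = {i, j} \<and> i \<in> A \<and> j \<in> B}"

datatype 'v edge_var = S_var "'v set" | T_var "'v set"

text \<open>\<open>S_G\<close> is \<open>poly_ring (partitions V)\<close>, with \<open>Var {A, B}\<close> in the role of \<open>q_{A|B}\<close>, and \<open>R_G\<close>
  is the set of polynomials in the variables \<open>S_var e\<close>, \<open>T_var e\<close> for \<open>e \<in> E\<close>;
  it contains all values of \<open>cut_hom E\<close>.\<close>

definition S_ring :: "'v set \<Rightarrow> ('v set set, 'k::zero) mpoly set" where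
  "S_ring V = poly_ring (partitions V)"

definition cut_hom ::
    "'v set set \<Rightarrow> ('v set set, 'k::field) mpoly \<Rightarrow> ('v edge_var, 'k) mpoly" where
  "cut_hom E = poly_subst
     (\<lambda>P. (\<Prod>e \<in> Cut E P. Var (S_var e)) * (\<Prod>e \<in> E - Cut E P. Var (T_var e)))"

definition cut_ideal :: "'v set \<Rightarrow> 'v set set \<Rightarrow> ('v set set, 'k::field) mpoly set" where
  "cut_ideal V E = {p \<in> S_ring V. cut_hom E p = 0}"

end

theory Submission imports Defs begin

text \<open>
  The homomorphism \<open>\<phi>\<^sub>G\<close> maps monomials to monomials, so \<open>I\<^sub>G\<close> vanishes iff the induced map on
  exponent vectors is injective. Write \<open>q\<^sub>A\<close> for the variable of the partition \<open>A|(V - A)\<close>.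
  If \<open>b\<close> and \<open>c\<close> are non-adjacent and \<open>|V| \<ge> 3\<close>, then \<open>q\<^bsub>{}\<^esub> q\<^bsub>{b,c}\<^esub> - q\<^bsub>{b}\<^esub> q\<^bsub>{c}\<^esub>\<close> is a
  nonzero element of \<open>I\<^sub>G\<close>. If \<open>|V| \<ge> 4\<close> and \<open>a\<close>, \<open>b\<close>, \<open>c\<close> are distinct vertices with
  \<open>D = V - {a,b,c}\<close>, then
  \<open>q\<^bsub>{a}\<^esub> q\<^bsub>{b}\<^esub> q\<^bsub>{c}\<^esub> q\<^bsub>D\<^esub> - q\<^bsub>{}\<^esub> q\<^bsub>{a,b}\<^esub> q\<^bsub>{a,c}\<^esub> q\<^bsub>{b,c}\<^esub>\<close> is one: in both monomials an
  edge between two of the four blocks is cut exactly twice and an edge inside a block never. For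
  \<open>K\<^sub>2\<close> and \<open>K\<^sub>3\<close> the exponents of a monomial can be solved for from those of its image.
\<close>

section \<open>Monomial substitutions as maps of exponent vectors\<close>

text \<open>The inner sum is the \<open>lookup m x\<close>-fold multiple of \<open>g x\<close>, so
  this is the additive map on exponent vectors that sends the unit vector of \<open>x\<close> to
  \<open>g x\<close>.\<close>

definition monom_image :: "('x \<Rightarrow> ('y \<Rightarrow>\<^sub>0 nat)) \<Rightarrow> ('x \<Rightarrow>\<^sub>0 nat) \<Rightarrow> ('y \<Rightarrow>\<^sub>0 nat)" where
  "monom_image g m = (\<Sum>x \<in> Poly_Mapping.keys m. \<Sum>i<Poly_Mapping.lookup m x. g x)"

text \<open>Any finite \<open>K\<close> above the support is allowed, so two monomials can share one
  index set and equality of their images becomes a linear system in the exponents.\<close>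

lemma lookup_monom_image:
  assumes "finite K" "Poly_Mapping.keys m \<subseteq> K"
  shows "Poly_Mapping.lookup (monom_image g m) y =
    (\<Sum>x\<in>K. Poly_Mapping.lookup m x * Poly_Mapping.lookup (g x) y)"
proof -
  have "Poly_Mapping.lookup (monom_image g m) y =
      (\<Sum>x\<in>Poly_Mapping.keys m. Poly_Mapping.lookup m x * Poly_Mapping.lookup (g x) y)"
    by (simp add: monom_image_def lookup_sum)
  also have "\<dots> = (\<Sum>x\<in>K. Poly_Mapping.lookup m x * Poly_Mapping.lookup (g x) y)"
    by (rule sum.mono_neutral_left) (use assms in \<open>auto simp: in_keys_iff\<close>)
  finally show ?thesis .
qed

lemma monom_image_add: "monom_image g (m + n) = monom_image g m + monom_image g n"
proof (rule poly_mapping_eqI)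
  fix y
  let ?K = "Poly_Mapping.keys m \<union> Poly_Mapping.keys n"
  have "Poly_Mapping.keys (m + n) \<subseteq> ?K"
    by (rule keys_add)
  then show "Poly_Mapping.lookup (monom_image g (m + n)) y =
      Poly_Mapping.lookup (monom_image g m + monom_image g n) y"
    by (simp add: lookup_monom_image[of ?K] lookup_add sum.distrib algebra_simps)
qed

lemma monom_image_single [simp]: "monom_image g (Poly_Mapping.single x (Suc 0)) = g x"
  by (simp add: monom_image_def)

lemma prod_single_one:
  "(\<Prod>x\<in>A. Poly_Mapping.single (h x) (1::'k::comm_semiring_1)) =
    Poly_Mapping.single (\<Sum>x\<in>A. h x :: 'y \<Rightarrow>\<^sub>0 nat) 1"
  by (induction A rule: infinite_finite_induct) (simp_all add: mult_single)

lemma poly_subst_monomials: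
  assumes f: "\<And>x. f x = Poly_Mapping.single (g x) (1::'k::comm_ring_1)"
    and K: "finite K" "Poly_Mapping.keys p \<subseteq> K"
  shows "poly_subst f p =
    (\<Sum>m\<in>K. Poly_Mapping.single (monom_image g m) (Poly_Mapping.lookup p m))"
proof -
  have pow: "f x ^ k = Poly_Mapping.single (\<Sum>i<k. g x) 1" for x k
    using prod_single_one[of "\<lambda>i. g x" "{..<k}", where ?'k='k] by (simp add: f)
  have "poly_subst f p =
      (\<Sum>m\<in>Poly_Mapping.keys p. Poly_Mapping.single (monom_image g m) (Poly_Mapping.lookup p m))"
    unfolding poly_subst_def pow prod_single_one
    by (simp add: Const_def mult_single monom_image_def)
  also have "\<dots> = (\<Sum>m\<in>K. Poly_Mapping.single (monom_image g m) (Poly_Mapping.lookup p m))"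
    by (rule sum.mono_neutral_left) (use K in \<open>auto simp: in_keys_iff\<close>)
  finally show ?thesis .
qed

text \<open>Injectivity keeps distinct monomials of \<open>p\<close> from merging, so every
  coefficient of \<open>p\<close> reappears as a coefficient of the image.\<close>

lemma poly_subst_monomials_eq_0:
  assumes f: "\<And>x. f x = Poly_Mapping.single (g x) (1::'k::comm_ring_1)"
    and inj: "inj_on (monom_image g) {m. Poly_Mapping.keys m \<subseteq> X}"
    and p: "p \<in> poly_ring X" "poly_subst f p = 0"
  shows "p = 0"
proof (rule poly_mapping_eqI)
  fix m
  show "Poly_Mapping.lookup p m = Poly_Mapping.lookup 0 m"
  proof (cases "m \<in> Poly_Mapping.keys p")
    case True
    have X: "Poly_Mapping.keys n \<subseteq> X" if "n \<in> Poly_Mapping.keys p" for n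
      using p(1) that by (auto simp: poly_ring_def)
    have "0 = Poly_Mapping.lookup (poly_subst f p) (monom_image g m)"
      by (simp add: p(2))
    also have "\<dots> = (\<Sum>n\<in>Poly_Mapping.keys p.
        Poly_Mapping.lookup p n when monom_image g n = monom_image g m)"
      by (simp add: poly_subst_monomials[OF f, of "Poly_Mapping.keys p"] lookup_sum lookup_single)
    also have "\<dots> = (\<Sum>n\<in>Poly_Mapping.keys p. if n = m then Poly_Mapping.lookup p n else 0)"
      using inj_onD[OF inj] X True by (intro sum.cong) (auto simp: when_def)
    also have "\<dots> = Poly_Mapping.lookup p m"
      using True by simp
    finally show ?thesis by simp
  qed (simp add: in_keys_iff)
qed

section \<open>Exponent vectors of cuts and the kernel of the cut homomorphism\<close>

definition cut_expo :: "'v set set \<Rightarrow> 'v set set \<Rightarrow> ('v edge_var \<Rightarrow>\<^sub>0 nat)" where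
  "cut_expo E P = (\<Sum>e\<in>Cut E P. Poly_Mapping.single (S_var e) 1) +
    (\<Sum>e\<in>E - Cut E P. Poly_Mapping.single (T_var e) 1)"

lemma finite_Cut: "finite E \<Longrightarrow> finite (Cut E P)"
  by (simp add: Cut_def)

lemma lookup_cut_expo:
  assumes "finite E"
  shows "Poly_Mapping.lookup (cut_expo E P) (S_var e) = of_bool (e \<in> Cut E P)"
    and "Poly_Mapping.lookup (cut_expo E P) (T_var e) = of_bool (e \<in> E - Cut E P)"
  using assms finite_Cut[OF assms, of P]
  by (simp_all add: cut_expo_def lookup_add lookup_sum lookup_single when_def)

lemma cut_variable_image:
  "(\<Prod>e \<in> Cut E P. Var (S_var e)) * (\<Prod>e \<in> E - Cut E P. Var (T_var e)) =
    Poly_Mapping.single (cut_expo E P) (1::'k::field)"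
  unfolding Var_def prod_single_one by (simp add: mult_single cut_expo_def)

lemma cut_ideal_eq_0:
  assumes "inj_on (monom_image (cut_expo E)) {m. Poly_Mapping.keys m \<subseteq> partitions V}"
  shows "(cut_ideal V E :: ('v set set, 'k::field) mpoly set) = {0}"
proof
  show "(cut_ideal V E :: ('v set set, 'k::field) mpoly set) \<subseteq> {0}"
    using poly_subst_monomials_eq_0[OF cut_variable_image assms]
    by (auto simp: cut_ideal_def cut_hom_def S_ring_def)
  show "{0} \<subseteq> (cut_ideal V E :: ('v set set, 'k::field) mpoly set)"
    by (simp add: cut_ideal_def cut_hom_def S_ring_def poly_ring_def poly_subst_def)
qed

text \<open>The difference of the two monomials is a nonzero binomial whose two image terms
  cancel.\<close>

lemma cut_ideal_neq_0:
  assumes keys: "Poly_Mapping.keys m \<subseteq> partitions V" "Poly_Mapping.keys n \<subseteq> partitions V"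
    and "m \<noteq> n" and eq: "monom_image (cut_expo E) m = monom_image (cut_expo E) n"
  shows "(cut_ideal V E :: ('v set set, 'k::field) mpoly set) \<noteq> {0}"
proof -
  define p :: "('v set set, 'k) mpoly" where
    "p = Poly_Mapping.single m 1 - Poly_Mapping.single n 1"
  have lookup: "Poly_Mapping.lookup p m = 1" "Poly_Mapping.lookup p n = -1"
    using \<open>m \<noteq> n\<close> by (simp_all add: p_def lookup_minus lookup_single)
  have sub: "Poly_Mapping.keys p \<subseteq> {m, n}"
    by (auto simp: p_def in_keys_iff lookup_minus lookup_single when_def split: if_splits)
  have "cut_hom E p = 0"
    unfolding cut_hom_def
    using \<open>m \<noteq> n\<close>
    by (simp add: poly_subst_monomials[OF cut_variable_image[of E] _ sub] lookup eq flip: single_add)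
  moreover have "p \<in> S_ring V"
    using sub keys by (auto simp: S_ring_def poly_ring_def)
  ultimately have "p \<in> cut_ideal V E"
    by (simp add: cut_ideal_def)
  moreover have "p \<noteq> 0"
    using lookup(1) by auto
  ultimately show ?thesis by blast
qed

section \<open>Partitions described by one side\<close>

text \<open>Naming a partition by one side makes cut membership a condition on that side; every
  partition gets two names, \<open>A\<close> and \<open>V - A\<close>.\<close>

definition part :: "'v set \<Rightarrow> 'v set \<Rightarrow> 'v set set" where
  "part V A = {A, V - A}"

lemma partitions_eq: "partitions V = part V ` Pow V"
proof -
  have "P \<in> part V ` Pow V" if P: "P \<in> partitions V" for P
  proof -
    obtain A B where AB: "P = {A, B}" "A \<union> B = V" "A \<inter> B = {}"
      using P unfolding partitions_def mem_Collect_eq by (elim exE conjE)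
    then have "B = V - A" "A \<subseteq> V" by auto
    with AB(1) show ?thesis by (simp add: part_def)
  qed
  moreover have "part V A \<in> partitions V" if "A \<subseteq> V" for A
    unfolding partitions_def part_def mem_Collect_eq
    by (intro exI[of _ A] exI[of _ "V - A"] conjI refl) (use that in auto)
  ultimately show ?thesis by (intro equalityI subsetI) (simp, elim imageE, simp)
qed

lemma part_in_partitions: "A \<subseteq> V \<Longrightarrow> part V A \<in> partitions V"
  by (simp add: partitions_eq)

lemma part_eq_iff:
  assumes "A \<subseteq> V" "B \<subseteq> V"
  shows "part V A = part V B \<longleftrightarrow> A = B \<or> A = V - B"
proof -
  have "V - A = B \<Longrightarrow> A = V - B" "V - A = V - B \<Longrightarrow> A = B" "A = V - B \<Longrightarrow> V - A = B"
    using assms by blast+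
  then show ?thesis unfolding part_def doubleton_eq_iff by metis
qed

text \<open>Both the partition and the edge are unordered pairs, so matching them with the witnesses
  in \<open>Cut\<close> leaves two cases, according to which endpoint lies in
  \<open>A\<close>.\<close>

lemma in_Cut_part:
  assumes "A \<subseteq> V" "i \<in> V" "j \<in> V"
  shows "{i, j} \<in> Cut E (part V A) \<longleftrightarrow> {i, j} \<in> E \<and> (i \<in> A \<longleftrightarrow> j \<notin> A)"
proof -
  have "i \<in> A \<and> j \<in> V - A \<or> j \<in> A \<and> i \<in> V - A"
    if "{A, V - A} = {A', B'}" "{i, j} = {i', j'}" "i' \<in> A'" "j' \<in> B'" for A' B' i' j'
    using that by (simp only: doubleton_eq_iff) (elim disjE conjE; simp)
  moreover have "\<exists>A' B' i' j'. {A, V - A} = {A', B'} \<and> {i, j} = {i', j'} \<and> i' \<in> A' \<and> j' \<in> B'"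
    if "i \<in> A \<and> j \<in> V - A \<or> j \<in> A \<and> i \<in> V - A"
    using that
  proof
    assume "i \<in> A \<and> j \<in> V - A"
    then show ?thesis by (intro exI[of _ A] exI[of _ "V - A"] exI[of _ i] exI[of _ j]) simp
  next
    assume "j \<in> A \<and> i \<in> V - A"
    then show ?thesis
      by (intro exI[of _ A] exI[of _ "V - A"] exI[of _ j] exI[of _ i]) (simp add: insert_commute)
  qed
  ultimately have "{i, j} \<in> Cut E (part V A) \<longleftrightarrow>
      {i, j} \<in> E \<and> (i \<in> A \<and> j \<in> V - A \<or> j \<in> A \<and> i \<in> V - A)"
    unfolding Cut_def part_def mem_Collect_eq by meson
  then show ?thesis using assms by blast
qed

lemma simple_graph_finite:
  assumes "simple_graph V E"
  shows "finite V" "finite E"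
proof -
  show "finite V" using assms by (simp add: simple_graph_def)
  moreover have "E \<subseteq> Pow V" using assms by (auto simp: simple_graph_def)
  ultimately show "finite E" by (simp add: finite_subset)
qed

lemma simple_graph_edgeE:
  assumes "simple_graph V E" "e \<in> E"
  obtains i j where "e = {i, j}" "i \<in> V" "j \<in> V" "i \<noteq> j"
proof -
  have "e \<subseteq> V" "card e = 2"
    using assms by (auto simp: simple_graph_def)
  then show ?thesis using that by (auto simp: card_2_iff)
qed

section \<open>Binomials in the cut ideal\<close>

text \<open>Only the numbers of cuts through each edge need comparison: the \<open>T_var\<close>
  exponents are then forced, because both products have equally many factors.\<close>

lemma cut_expo_sum_eqI:
  assumes G: "simple_graph V E"
    and As: "\<Union>(set As) \<subseteq> V" and Bs: "\<Union>(set Bs) \<subseteq> V"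
    and len: "length As = length Bs"
    and eq: "\<And>i j. {i, j} \<in> E \<Longrightarrow> i \<in> V \<Longrightarrow> j \<in> V \<Longrightarrow> i \<noteq> j \<Longrightarrow>
      (\<Sum>A\<leftarrow>As. of_bool (i \<in> A \<longleftrightarrow> j \<notin> A)) = (\<Sum>B\<leftarrow>Bs. of_bool (i \<in> B \<longleftrightarrow> j \<notin> B) :: nat)"
  shows "(\<Sum>A\<leftarrow>As. cut_expo E (part V A)) = (\<Sum>B\<leftarrow>Bs. cut_expo E (part V B))"
proof (rule poly_mapping_eqI)
  note fin = simple_graph_finite[OF G]
  have lookup_sum_list: "Poly_Mapping.lookup (\<Sum>A\<leftarrow>Cs. cut_expo E (part V A)) y =
      (\<Sum>A\<leftarrow>Cs. Poly_Mapping.lookup (cut_expo E (part V A)) y)" for Cs y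
    by (induction Cs) (simp_all add: lookup_add)
  have S: "(\<Sum>A\<leftarrow>Cs. of_bool ({i, j} \<in> Cut E (part V A))) =
      (\<Sum>A\<leftarrow>Cs. of_bool (i \<in> A \<longleftrightarrow> j \<notin> A) :: nat)"
    if "\<Union>(set Cs) \<subseteq> V" "{i, j} \<in> E" "i \<in> V" "j \<in> V" for Cs i j
    using that by (induction Cs) (simp_all add: in_Cut_part)
  \<comment> \<open>Every factor contributes to exactly one of the two variables of
    \<open>e\<close>, so their exponents add up to the degree.\<close>
  have T: "(\<Sum>A\<leftarrow>Cs. of_bool (e \<in> E - Cut E (part V A))) +
      (\<Sum>A\<leftarrow>Cs. of_bool (e \<in> Cut E (part V A))) = (length Cs :: nat)" if "e \<in> E" for Cs e
    using that by (induction Cs) auto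
  have Seq: "(\<Sum>A\<leftarrow>As. of_bool (e \<in> Cut E (part V A))) =
      (\<Sum>A\<leftarrow>Bs. of_bool (e \<in> Cut E (part V A)) :: nat)" if e: "e \<in> E" for e
  proof -
    obtain i j where "e = {i, j}" "i \<in> V" "j \<in> V" "i \<noteq> j"
      by (rule simple_graph_edgeE[OF G e])
    then show ?thesis
      using e S[OF As, of i j] S[OF Bs, of i j] eq[of i j] by simp
  qed
  fix y
  show "Poly_Mapping.lookup (\<Sum>A\<leftarrow>As. cut_expo E (part V A)) y =
      Poly_Mapping.lookup (\<Sum>B\<leftarrow>Bs. cut_expo E (part V B)) y"
  proof (cases y)
    case (S_var e)
    show ?thesis
    proof (cases "e \<in> E")
      case True
      then show ?thesis
        using Seq by (simp add: S_var lookup_sum_list lookup_cut_expo[OF fin(2)])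
    next
      case False
      then have "e \<notin> Cut E P" for P by (simp add: Cut_def)
      then show ?thesis
        by (simp add: S_var lookup_sum_list lookup_cut_expo[OF fin(2)])
    qed
  next
    case (T_var e)
    show ?thesis
    proof (cases "e \<in> E")
      case True
      then show ?thesis
        using T[OF True, of As] T[OF True, of Bs] Seq[OF True] len
        by (simp only: T_var lookup_sum_list lookup_cut_expo[OF fin(2)])
    next
      case False
      then show ?thesis
        by (simp add: T_var lookup_sum_list lookup_cut_expo[OF fin(2)])
    qed
  qed
qed

text \<open>The lists encode the binomial \<open>\<Prod>\<^bsub>A\<in>As\<^esub> q\<^sub>A - q\<^bsub>{}\<^esub> \<Prod>\<^bsub>B\<in>Bs\<^esub> q\<^sub>B\<close>, which is not zero
  because \<open>q\<^bsub>{}\<^esub>\<close> occurs only in the second monomial.\<close>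

lemma cut_ideal_neq_0I:
  assumes G: "simple_graph V E"
    and As: "\<And>A. A \<in> set As \<Longrightarrow> A \<subseteq> V \<and> A \<noteq> {} \<and> A \<noteq> V" and Bs: "\<Union>(set Bs) \<subseteq> V"
    and "length As = Suc (length Bs)"
    and "\<And>i j. {i, j} \<in> E \<Longrightarrow> i \<in> V \<Longrightarrow> j \<in> V \<Longrightarrow> i \<noteq> j \<Longrightarrow>
      (\<Sum>A\<leftarrow>As. of_bool (i \<in> A \<longleftrightarrow> j \<notin> A)) = (\<Sum>B\<leftarrow>Bs. of_bool (i \<in> B \<longleftrightarrow> j \<notin> B) :: nat)"
  shows "(cut_ideal V E :: ('v set set, 'k::field) mpoly set) \<noteq> {0}"
proof -
  define mon :: "'v set list \<Rightarrow> ('v set set \<Rightarrow>\<^sub>0 nat)" where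
    "mon Cs = (\<Sum>A\<leftarrow>Cs. Poly_Mapping.single (part V A) 1)" for Cs
  have image: "monom_image (cut_expo E) (mon Cs) = (\<Sum>A\<leftarrow>Cs. cut_expo E (part V A))" for Cs
    by (induction Cs) (simp_all add: mon_def monom_image_add, simp add: monom_image_def)
  have keys: "Poly_Mapping.keys (mon Cs) \<subseteq> partitions V" if "\<Union>(set Cs) \<subseteq> V" for Cs
    using that
  proof (induction Cs)
    case (Cons A Cs)
    then have "part V A \<in> partitions V" by (simp add: part_in_partitions)
    then show ?case
      using Cons keys_add[of "Poly_Mapping.single (part V A) 1" "mon Cs"]
      by (auto simp: mon_def split: if_splits)
  qed (simp add: mon_def)
  have "Poly_Mapping.lookup (mon As) (part V {}) = 0"
    using As
  proof (induction As)
    case (Cons A Cs)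
    \<comment> \<open>The sides of \<open>part V {}\<close> are \<open>{}\<close> and
      \<open>V\<close>, and \<open>A\<close> is neither of them.\<close>
    then have "part V A \<noteq> part V {}" by (subst part_eq_iff) auto
    with Cons show ?case by (simp add: mon_def lookup_add lookup_single)
  qed (simp add: mon_def)
  moreover have "Poly_Mapping.lookup (mon ({} # Bs)) (part V {}) > 0"
    by (simp add: mon_def lookup_add lookup_single)
  ultimately have "mon As \<noteq> mon ({} # Bs)" by auto
  moreover have "\<Union>(set As) \<subseteq> V" using As by auto
  ultimately show ?thesis
    using assms cut_expo_sum_eqI[OF G, of As "{} # Bs"]
    by (intro cut_ideal_neq_0[of "mon As" _ "mon ({} # Bs)"] keys) (simp_all add: image)
qed

text \<open>The pair \<open>{b, c}\<close> is the only one that the two monomials would treat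
  differently, being separated twice by the first and never by the second, and it is not an
  edge.\<close>

lemma cut_ideal_neq_0_nonadjacent:
  assumes G: "simple_graph V E" and "b \<in> V" "c \<in> V" "b \<noteq> c" "{b, c} \<notin> E" "V \<noteq> {b, c}"
  shows "(cut_ideal V E :: ('v set set, 'k::field) mpoly set) \<noteq> {0}"
proof (rule cut_ideal_neq_0I[OF G, of "[{b}, {c}]" "[{b, c}]"])
  show "A \<subseteq> V \<and> A \<noteq> {} \<and> A \<noteq> V" if "A \<in> set [{b}, {c}]" for A
    using that assms(2-4) by auto
  show "(\<Sum>A\<leftarrow>[{b}, {c}]. of_bool (i \<in> A \<longleftrightarrow> j \<notin> A)) =
      (\<Sum>B\<leftarrow>[{b, c}]. of_bool (i \<in> B \<longleftrightarrow> j \<notin> B) :: nat)"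
    if "{i, j} \<in> E" for i j
  proof -
    have "\<not> (i = b \<and> j = c)" "\<not> (i = c \<and> j = b)"
      using that assms(5) by (auto simp: insert_commute)
    then show ?thesis
      using assms(4) by (cases "i = b"; cases "i = c"; cases "j = b"; cases "j = c") simp_all
  qed
qed (use assms(2,3) in auto)

lemma cut_ideal_neq_0_four_blocks:
  assumes G: "simple_graph V E"
    and "a \<in> V" "b \<in> V" "c \<in> V" "a \<noteq> b" "a \<noteq> c" "b \<noteq> c" "V \<noteq> {a, b, c}"
  shows "(cut_ideal V E :: ('v set set, 'k::field) mpoly set) \<noteq> {0}"
proof (rule cut_ideal_neq_0I[OF G, of "[{a}, {b}, {c}, V - {a, b, c}]" "[{a, b}, {a, c}, {b, c}]"])
  \<comment> \<open>If the fourth block were empty, the variable of \<open>part V {}\<close> would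
    occur in both monomials.\<close>
  have "V - {a, b, c} \<noteq> {}" using assms by blast
  then show "A \<subseteq> V \<and> A \<noteq> {} \<and> A \<noteq> V" if "A \<in> set [{a}, {b}, {c}, V - {a, b, c}]" for A
    using that assms by auto
  show "(\<Sum>A\<leftarrow>[{a}, {b}, {c}, V - {a, b, c}]. of_bool (i \<in> A \<longleftrightarrow> j \<notin> A)) =
      (\<Sum>B\<leftarrow>[{a, b}, {a, c}, {b, c}]. of_bool (i \<in> B \<longleftrightarrow> j \<notin> B) :: nat)"
    if "i \<in> V" "j \<in> V" for i j
    using that assms(5-7)
    by (cases "i = a"; cases "i = b"; cases "i = c"; cases "j = a"; cases "j = b"; cases "j = c") simp_all
qed (use assms in auto)

section \<open>Complete graphs on two and three vertices\<close>

text \<open>Adjacency of all pairs is preserved by every bijection of the vertices, so any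
  enumeration of \<open>V\<close> serves as the isomorphism.\<close>

lemma complete_graph_iff:
  assumes G: "simple_graph V E"
  shows "is_complete_graph n V E \<longleftrightarrow> card V = n \<and> (\<forall>u\<in>V. \<forall>v\<in>V. u \<noteq> v \<longrightarrow> {u, v} \<in> E)"
proof
  assume "is_complete_graph n V E"
  then obtain f where f: "bij_betw f V {..<n}"
    and E: "\<And>u v. u \<in> V \<Longrightarrow> v \<in> V \<Longrightarrow> {u, v} \<in> E \<longleftrightarrow> {f u, f v} \<in> complete_edges n"
    by (auto simp: is_complete_graph_def graph_iso_def)
  have "card V = n" using bij_betw_same_card[OF f] by simp
  moreover have "{u, v} \<in> E" if "u \<in> V" "v \<in> V" "u \<noteq> v" for u v
  proof -
    have "f u \<noteq> f v" using f that by (auto simp: bij_betw_def inj_on_def)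
    then show ?thesis
      using bij_betwE[OF f] that by (simp add: E complete_edges_def)
  qed
  ultimately show "card V = n \<and> (\<forall>u\<in>V. \<forall>v\<in>V. u \<noteq> v \<longrightarrow> {u, v} \<in> E)" by blast
next
  assume *: "card V = n \<and> (\<forall>u\<in>V. \<forall>v\<in>V. u \<noteq> v \<longrightarrow> {u, v} \<in> E)"
  obtain f where f: "bij_betw f V {..<n}"
    using * simple_graph_finite(1)[OF G] ex_bij_betw_finite_nat[of V]
    by (auto simp: atLeast0LessThan)
  have "{u, v} \<in> E \<longleftrightarrow> {f u, f v} \<in> complete_edges n" if "u \<in> V" "v \<in> V" for u v
  proof (cases "u = v")
    case True
    \<comment> \<open>Here \<open>{u, v}\<close> is a singleton, hence an edge on neither
      side.\<close>
    then show ?thesis using G by (auto simp: simple_graph_def complete_edges_def)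
  next
    case False
    then have "f u \<noteq> f v" using f that by (auto simp: bij_betw_def inj_on_def)
    then show ?thesis
      using bij_betwE[OF f] that False * by (simp add: complete_edges_def)
  qed
  with f show "is_complete_graph n V E"
    by (auto simp: is_complete_graph_def graph_iso_def)
qed

text \<open>Exponents outside \<open>X\<close> vanish, so it suffices that the linear system given
  by the coordinates of the image has at most one solution on \<open>X\<close>.\<close>

lemma inj_on_monom_imageI:
  assumes X: "finite X"
    and solve: "\<And>m n :: 'x \<Rightarrow> nat. (\<And>y. (\<Sum>x\<in>X. m x * Poly_Mapping.lookup (g x) y) =
      (\<Sum>x\<in>X. n x * Poly_Mapping.lookup (g x) y)) \<Longrightarrow> \<forall>x\<in>X. m x = n x"
  shows "inj_on (monom_image g) {m. Poly_Mapping.keys m \<subseteq> X}"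
proof (rule inj_onI)
  fix m n assume *: "m \<in> {m. Poly_Mapping.keys m \<subseteq> X}" "n \<in> {m. Poly_Mapping.keys m \<subseteq> X}"
    and eq: "monom_image g m = monom_image g n"
  have on: "\<forall>x\<in>X. Poly_Mapping.lookup m x = Poly_Mapping.lookup n x"
    using * X by (intro solve) (simp add: eq flip: lookup_monom_image)
  show "m = n"
  proof (rule poly_mapping_eqI)
    fix x
    show "Poly_Mapping.lookup m x = Poly_Mapping.lookup n x"
    proof (cases "x \<in> X")
      case False
      then have "x \<notin> Poly_Mapping.keys m" "x \<notin> Poly_Mapping.keys n" using * by auto
      then show ?thesis by (simp add: in_keys_iff)
    qed (use on in blast)
  qed
qed

text \<open>The edge is cut by \<open>?A\<close> and not by \<open>?O\<close>, so its
  \<open>S_var\<close> and \<open>T_var\<close> coordinates are the exponents of these two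
  variables.\<close>

lemma cut_ideal_K2:
  assumes V: "V = {a, b}" "a \<noteq> b" and E: "finite E" "{a, b} \<in> E"
  shows "(cut_ideal V E :: ('v set set, 'k::field) mpoly set) = {0}"
proof (rule cut_ideal_eq_0, rule inj_on_monom_imageI)
  show "finite (partitions V)" by (simp add: partitions_eq V)
  let ?O = "part V {}" and ?A = "part V {a}"
  have P: "partitions V = {?O, ?A}"
  proof -
    have "?A = part V {b}" "?O = part V {a, b}" using V by (simp_all add: part_eq_iff) auto
    then show ?thesis by (simp add: partitions_eq Pow_insert V(1) insert_commute)
  qed
  have neq: "?O \<noteq> ?A"
    using V by (simp add: part_eq_iff)
  have cut: "{a, b} \<notin> Cut E ?O" "{a, b} \<in> Cut E ?A"
    using V E by (auto simp: in_Cut_part)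
  fix m n :: "'v set set \<Rightarrow> nat"
  assume *: "\<And>y. (\<Sum>x\<in>partitions V. m x * Poly_Mapping.lookup (cut_expo E x) y) =
      (\<Sum>x\<in>partitions V. n x * Poly_Mapping.lookup (cut_expo E x) y)"
  show "\<forall>x\<in>partitions V. m x = n x"
    using *[of "S_var {a, b}"] *[of "T_var {a, b}"] neq cut E
    by (simp add: P lookup_cut_expo)
qed

text \<open>The \<open>S_var\<close> coordinates of the three edges are the pairwise sums of the
  exponents of \<open>?A\<close>, \<open>?B\<close> and \<open>?C\<close>, which determine all
  three. The \<open>T_var {a, b}\<close> coordinate adds the exponents of \<open>?O\<close> and
  \<open>?C\<close> and so yields that of \<open>?O\<close>.\<close>

lemma cut_ideal_K3:
  assumes V: "V = {a, b, c}" "a \<noteq> b" "a \<noteq> c" "b \<noteq> c"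
    and E: "finite E" "{a, b} \<in> E" "{a, c} \<in> E" "{b, c} \<in> E"
  shows "(cut_ideal V E :: ('v set set, 'k::field) mpoly set) = {0}"
proof (rule cut_ideal_eq_0, rule inj_on_monom_imageI)
  show "finite (partitions V)" by (simp add: partitions_eq V)
  let ?O = "part V {}" and ?A = "part V {a}" and ?B = "part V {b}" and ?C = "part V {c}"
  have P: "partitions V = {?O, ?A, ?B, ?C}"
  proof -
    \<comment> \<open>Complementary sets name the same partition, which merges the eight subsets of
      \<open>V\<close> into four partitions.\<close>
    have "?A = part V {b, c}" "?B = part V {a, c}" "?C = part V {a, b}" "?O = part V {a, b, c}"
      using V by (simp_all add: part_eq_iff) auto
    then show ?thesis by (simp add: partitions_eq Pow_insert V(1) insert_commute)
  qed
  have cut: "{a, b} \<notin> Cut E ?O" "{a, b} \<in> Cut E ?A" "{a, b} \<in> Cut E ?B" "{a, b} \<notin> Cut E ?C"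
      "{a, c} \<notin> Cut E ?O" "{a, c} \<in> Cut E ?A" "{a, c} \<notin> Cut E ?B" "{a, c} \<in> Cut E ?C"
      "{b, c} \<notin> Cut E ?O" "{b, c} \<notin> Cut E ?A" "{b, c} \<in> Cut E ?B" "{b, c} \<in> Cut E ?C"
    using V(2-4) E by (auto simp: in_Cut_part V(1))
  \<comment> \<open>Any two of the four partitions differ on whether some edge is cut.\<close>
  have neq: "?O \<noteq> ?A" "?O \<noteq> ?B" "?O \<noteq> ?C" "?A \<noteq> ?B" "?A \<noteq> ?C" "?B \<noteq> ?C"
    using cut by metis+
  fix m n :: "'v set set \<Rightarrow> nat"
  assume *: "\<And>y. (\<Sum>x\<in>partitions V. m x * Poly_Mapping.lookup (cut_expo E x) y) =
      (\<Sum>x\<in>partitions V. n x * Poly_Mapping.lookup (cut_expo E x) y)"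
  show "\<forall>x\<in>partitions V. m x = n x"
    using *[of "S_var {a, b}"] *[of "S_var {a, c}"] *[of "S_var {b, c}"] *[of "T_var {a, b}"]
      neq cut E
    by (simp add: P lookup_cut_expo)
qed

section \<open>Graphs with zero cut ideal\<close>

theorem proposition3p1:
  fixes V :: "'v set" and E :: "'v set set"
  assumes "simple_graph V E" and "card E \<ge> 1"
  shows "(cut_ideal V E :: ('v set set, 'k::field) mpoly set) = {0} \<longleftrightarrow>
         is_complete_graph 2 V E \<or> is_complete_graph 3 V E"
proof
  note G = assms(1)
  assume zero: "(cut_ideal V E :: ('v set set, 'k::field) mpoly set) = {0}"
  obtain e where e: "e \<in> E" using assms(2) by fastforce
  obtain a b where ab: "e = {a, b}" "a \<in> V" "b \<in> V" "a \<noteq> b"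
    by (rule simple_graph_edgeE[OF G e])
  show "is_complete_graph 2 V E \<or> is_complete_graph 3 V E"
  proof (cases "V = {a, b}")
    case True
    then have "is_complete_graph 2 V E"
      unfolding complete_graph_iff[OF G] using ab e by (auto simp: insert_commute)
    then show ?thesis ..
  next
    case False
    then obtain c where c: "c \<in> V" "c \<noteq> a" "c \<noteq> b" using ab by blast
    \<comment> \<open>A fourth vertex would produce the binomial of degree four.\<close>
    then have V: "V = {a, b, c}"
      using cut_ideal_neq_0_four_blocks[OF G, of a b c] ab zero by blast
    have card: "card V = 3" using V c ab by simp
    have "{u, v} \<in> E" if "u \<in> V" "v \<in> V" "u \<noteq> v" for u v
    proof (rule ccontr)
      \<comment> \<open>A missing edge would produce the quadratic binomial.\<close>
      assume "{u, v} \<notin> E"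
      moreover have "V \<noteq> {u, v}"
        using card that by auto
      ultimately show False
        using cut_ideal_neq_0_nonadjacent[OF G that] zero by blast
    qed
    with card have "is_complete_graph 3 V E"
      by (simp add: complete_graph_iff[OF G])
    then show ?thesis ..
  qed
next
  note G = assms(1)
  note fin = simple_graph_finite(2)[OF G]
  assume "is_complete_graph 2 V E \<or> is_complete_graph 3 V E"
  then consider "card V = 2" | "card V = 3"
    by (auto simp: complete_graph_iff[OF G])
  moreover have adj: "{u, v} \<in> E" if "u \<in> V" "v \<in> V" "u \<noteq> v" for u v
    using \<open>is_complete_graph 2 V E \<or> is_complete_graph 3 V E\<close> that
    by (auto simp: complete_graph_iff[OF G])
  ultimately show "(cut_ideal V E :: ('v set set, 'k::field) mpoly set) = {0}"
  proof cases
    case 1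
    then obtain a b where V: "V = {a, b}" "a \<noteq> b" by (auto simp: card_2_iff)
    then show ?thesis using adj by (intro cut_ideal_K2[OF V fin]) simp
  next
    case 2
    then obtain a b c where V: "V = {a, b, c}" "a \<noteq> b" "a \<noteq> c" "b \<noteq> c"
      by (auto simp: card_3_iff)
    then show ?thesis using adj by (intro cut_ideal_K3[OF V fin]) simp_all
  qed
qed

end
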